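(* Let $m\ge 0$ and $k\ge 1$ be integers, let $G$ be a finite graph, let $X,Y\subseteq V(G)$, let $\mathcal P$ be a collection of $2^m k$ pairwise vertex-disjoint $X$-$Y$-paths in $G$, and let $\mathcal M$ be a partition of $E(G[V(\mathcal P)])\setminus E(\mathcal P)$ into $m$ induced matchings of $G$. Then there exist $k$ pairwise non-adjacent $X$-$Y$-paths in $G$.
   Context: An $X$-$Y$-path is a path with one endpoint in $X$ and the other endpoint in $Y$; a single vertex of $X\cap Y$ counts as an $X$-$Y$-path. For a collection $\mathcal P$ of paths, $V(\mathcal P)=\bigcup_{P\in\mathcal P}V(P)$ and $E(\mathcal P)=\bigcup_{P\in\mathcal P}E(P)$; $G[S]$ denotes the subgraph induced by $S$. An induced matching of $G$ is a set $M\subseteq E(G)$ such that any two distinct edges of $M$ share no vertex and no edge of $G$ joins an endpoint of one to an endpoint of the other. Paths are pairwise non-adjacent if they are pairwise vertex-disjoint and no edge of $G$ joins vertices of two different ones. *)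

theory Defs
  imports Main "HOL-Library.Disjoint_Sets"
begin

definition finite_graph :: "'a set \<Rightarrow> 'a set set \<Rightarrow> bool" where
  "finite_graph V E \<longleftrightarrow> finite V \<and> (\<forall>e\<in>E. e \<subseteq> V \<and> card e = 2)"

definition induced_edges :: "'a set set \<Rightarrow> 'a set \<Rightarrow> 'a set set" where
  "induced_edges E S = {e \<in> E. e \<subseteq> S}"

text \<open>A path is given by the list of its vertices in order; a list and its reverse
  represent the same path.\<close>

definition path_edges :: "'a list \<Rightarrow> 'a set set" where
  "path_edges p = {{p ! i, p ! Suc i} | i. Suc i < length p}"

definition is_path :: "'a set \<Rightarrow> 'a set set \<Rightarrow> 'a list \<Rightarrow> bool" where
  "is_path V E p \<longleftrightarrow> p \<noteq> [] \<and> distinct p \<and> set p \<subseteq> V \<and> path_edges p \<subseteq> E"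

definition is_XY_path :: "'a set \<Rightarrow> 'a set set \<Rightarrow> 'a set \<Rightarrow> 'a set \<Rightarrow> 'a list \<Rightarrow> bool" where
  "is_XY_path V E X Y p \<longleftrightarrow> is_path V E p \<and>
     (hd p \<in> X \<and> last p \<in> Y \<or> hd p \<in> Y \<and> last p \<in> X)"

definition vertex_disjoint :: "'a list \<Rightarrow> 'a list \<Rightarrow> bool" where
  "vertex_disjoint p q \<longleftrightarrow> set p \<inter> set q = {}"

definition non_adjacent :: "'a set set \<Rightarrow> 'a list \<Rightarrow> 'a list \<Rightarrow> bool" where
  "non_adjacent E p q \<longleftrightarrow> vertex_disjoint p q \<and> (\<forall>u\<in>set p. \<forall>v\<in>set q. {u, v} \<notin> E)"

definition paths_verts :: "'a list set \<Rightarrow> 'a set" where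
  "paths_verts P = (\<Union>p\<in>P. set p)"

definition paths_edges :: "'a list set \<Rightarrow> 'a set set" where
  "paths_edges P = (\<Union>p\<in>P. path_edges p)"

definition induced_matching :: "'a set set \<Rightarrow> 'a set set \<Rightarrow> bool" where
  "induced_matching E M \<longleftrightarrow> M \<subseteq> E \<and>
     (\<forall>e\<in>M. \<forall>f\<in>M. e \<noteq> f \<longrightarrow> e \<inter> f = {} \<and> (\<forall>u\<in>e. \<forall>v\<in>f. {u, v} \<notin> E))"

text \<open>The parts are indexed by the numbers below \<open>m\<close>, so that some of them may be empty
  (the empty set is an induced matching).\<close>

definition partition_into_induced_matchings ::
  "'a set set \<Rightarrow> nat \<Rightarrow> (nat \<Rightarrow> 'a set set) \<Rightarrow> 'a set set \<Rightarrow> bool" where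
  "partition_into_induced_matchings E m M F \<longleftrightarrow>
     (\<Union>i<m. M i) = F \<and> disjoint_family_on M {..<m} \<and> (\<forall>i<m. induced_matching E (M i))"

end

theory Submission
  imports Defs
begin

text \<open>
  Induction on the number of matchings. First shorten the paths so that each meets \<open>X\<close> only in its
  first and \<open>Y\<close> only in its last vertex. Let \<open>N\<close> be one of the matchings and contract its edges in the
  union of the paths and \<open>N\<close>. A set of \<open>t\<close> vertices separating \<open>X\<close> from \<open>Y\<close> after the contraction
  comes from at most \<open>2 t\<close> vertices meeting all the given paths, so by Menger's theorem half as many
  disjoint \<open>X\<close>-\<open>Y\<close>-paths survive. They lift to disjoint paths all of whose induced \<open>N\<close>-edges are path
  edges. An old path edge \<open>{a, b}\<close> cannot turn into a new non-path edge: counting degrees, both \<open>a\<close>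
  and \<open>b\<close> would then lie on edges of \<open>N\<close>, contradicting that \<open>N\<close> is induced. Hence the remaining
  matchings cover all non-path edges of the new family.
\<close>

section \<open>Menger's theorem for finite relations\<close>

text \<open>Walks are directed and may repeat vertices: two walks can be glued without shortening,
  and the image of a path under a contraction is again a walk.\<close>

definition walk :: "('a \<times> 'a) set \<Rightarrow> 'a set \<Rightarrow> 'a set \<Rightarrow> 'a list \<Rightarrow> bool" where
  "walk R A B w \<longleftrightarrow> w \<noteq> [] \<and> hd w \<in> A \<and> last w \<in> B \<and> successively (\<lambda>u v. (u, v) \<in> R) w"

definition separates :: "('a \<times> 'a) set \<Rightarrow> 'a set \<Rightarrow> 'a set \<Rightarrow> 'a set \<Rightarrow> bool" where
  "separates R A B T \<longleftrightarrow> (\<forall>w. walk R A B w \<longrightarrow> set w \<inter> T \<noteq> {})"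

definition linked :: "('a \<times> 'a) set \<Rightarrow> 'a set \<Rightarrow> 'a set \<Rightarrow> nat \<Rightarrow> bool" where
  "linked R A B n \<longleftrightarrow> (\<exists>F. finite F \<and> card F = n \<and> (\<forall>p\<in>F. walk R A B p \<and> distinct p) \<and>
     pairwise vertex_disjoint F)"

lemma walk_rev: "walk (R\<inverse>) B A (rev w) \<longleftrightarrow> walk R A B w"
  by (auto simp: walk_def hd_rev last_rev)

lemma walk_mono: "walk R A B w \<Longrightarrow> R \<subseteq> R' \<Longrightarrow> walk R' A B w"
  by (auto simp: walk_def intro: successively_mono)

lemma linked_mono: "linked R A B n \<Longrightarrow> R \<subseteq> R' \<Longrightarrow> linked R' A B n"
  unfolding linked_def using walk_mono by metis

lemma walk_prefix:
  assumes "walk R A B (us @ v # vs)"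
  shows "walk R A {v} (us @ [v])"
  using assms by (auto simp: walk_def successively_append_iff hd_append)

lemma walk_suffix:
  assumes "walk R A B (us @ v # vs)"
  shows "walk R {v} B (v # vs)"
  using assms by (auto simp: walk_def successively_append_iff)

lemma walk_glue:
  assumes "walk R A {v} (us @ [v])" and "walk R {v} B (v # vs)"
  shows "walk R A B (us @ v # vs)"
  using assms by (auto simp: walk_def successively_append_iff hd_append)

lemma separates_converse: "separates (R\<inverse>) B A T \<longleftrightarrow> separates R A B T"
  unfolding separates_def by (metis walk_rev rev_rev_ident set_rev converse_converse)

lemma linked_converse:
  assumes "linked R A B n"
  shows "linked (R\<inverse>) B A n"
proof -
  obtain F where F: "finite F" "card F = n" "\<forall>p\<in>F. walk R A B p \<and> distinct p"
    "pairwise vertex_disjoint F"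
    using assms by (auto simp: linked_def)
  have "card (rev ` F) = n" using F(2) by (simp add: card_image)
  moreover have "pairwise vertex_disjoint (rev ` F)"
    using F(4) by (auto simp: pairwise_def vertex_disjoint_def)
  moreover have "\<forall>p\<in>rev ` F. walk (R\<inverse>) B A p \<and> distinct p"
    using F(3) walk_rev by fastforce
  ultimately show ?thesis using F(1) unfolding linked_def by blast
qed

text \<open>The \<open>n\<close> disjoint paths have distinct last vertices in \<open>Z\<close>, and
  \<open>card Z = n\<close> makes these exhaust \<open>Z\<close>. A further vertex of
  \<open>Z\<close> on a path would be the last vertex of another path, against disjointness.\<close>

lemma linked_onto:
  assumes "linked R A Z n" and "finite Z" and "card Z = n"
  obtains p where "\<And>z. z \<in> Z \<Longrightarrow> walk R A {z} (p z) \<and> distinct (p z) \<and> set (p z) \<inter> Z = {z}"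
    and "\<And>z z'. z \<in> Z \<Longrightarrow> z' \<in> Z \<Longrightarrow> z \<noteq> z' \<Longrightarrow> set (p z) \<inter> set (p z') = {}"
proof -
  obtain F where F: "finite F" "card F = n" "\<forall>p\<in>F. walk R A Z p \<and> distinct p"
    "pairwise vertex_disjoint F"
    using assms by (auto simp: linked_def)
  have last_in: "last p \<in> set p" "last p \<in> Z" if "p \<in> F" for p
    using F(3) that by (auto simp: walk_def)
  have disj: "p = q" if "p \<in> F" "q \<in> F" "v \<in> set p" "v \<in> set q" for p q v
    using F(4) that by (auto simp: pairwise_def vertex_disjoint_def)
  have inj: "inj_on last F"
    using last_in disj by (metis inj_onI)
  have "last ` F = Z"
    by (intro card_subset_eq assms(2)) (use last_in in \<open>auto simp: card_image[OF inj] F assms\<close>)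
  then have pz: "inv_into F last z \<in> F" "last (inv_into F last z) = z" if "z \<in> Z" for z
    using that by (auto simp: inv_into_into f_inv_into_f)
  show ?thesis
  proof (rule that[of "inv_into F last"])
    fix z assume z: "z \<in> Z"
    have "w = z" if "w \<in> set (inv_into F last z)" "w \<in> Z" for w
      using disj[OF pz(1)[OF z] pz(1)[OF that(2)] that(1)] last_in(1)[OF pz(1)[OF that(2)]]
        pz(2) z that
      by metis
    moreover have "z \<in> set (inv_into F last z)"
      using last_in(1)[OF pz(1)[OF z]] pz(2)[OF z] by simp
    moreover have "walk R A {z} (inv_into F last z) \<and> distinct (inv_into F last z)"
      using F(3) pz[OF z] by (auto simp: walk_def)
    ultimately show "walk R A {z} (inv_into F last z) \<and> distinct (inv_into F last z) \<and>
        set (inv_into F last z) \<inter> Z = {z}"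
      using z by blast
  next
    fix z z' assume "z \<in> Z" "z' \<in> Z" "z \<noteq> z'"
    then show "set (inv_into F last z) \<inter> set (inv_into F last z') = {}"
      using disj pz by (metis disjoint_iff)
  qed
qed

text \<open>The edge \<open>(x, y)\<close> can be used only after reaching \<open>x\<close>, so
  cutting at the first \<open>x\<close> leaves a prefix free of it.\<close>

lemma successively_remove_edge:
  assumes "successively (\<lambda>u v. (u, v) \<in> R) w"
  shows "successively (\<lambda>u v. (u, v) \<in> R - {(x, y)}) w \<or>
    (\<exists>us vs. w = us @ x # vs \<and> successively (\<lambda>u v. (u, v) \<in> R - {(x, y)}) (us @ [x]))"
  using assms
proof (induction w)
  case Nil
  then show ?case by simp
next
  case (Cons a w)
  show ?case
  proof (cases "a = x")
    case True
    then show ?thesis by (intro disjI2 exI[of _ "[]"] exI[of _ w]) auto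
  next
    case False
    have "successively (\<lambda>u v. (u, v) \<in> R) w" using Cons.prems by (cases w) auto
    from Cons.IH[OF this] show ?thesis
    proof (elim disjE exE conjE)
      assume "successively (\<lambda>u v. (u, v) \<in> R - {(x, y)}) w"
      then show ?thesis using Cons.prems False by (cases w) auto
    next
      fix us vs assume *: "w = us @ x # vs"
        "successively (\<lambda>u v. (u, v) \<in> R - {(x, y)}) (us @ [x])"
      then have "successively (\<lambda>u v. (u, v) \<in> R - {(x, y)}) ((a # us) @ [x])"
        using Cons.prems False by (cases us) auto
      then show ?thesis using *(1) by (metis append_Cons)
    qed
  qed
qed

text \<open>Every walk in \<open>R\<close> from \<open>A\<close> to \<open>B\<close> has an initial
  part that reaches \<open>insert x S\<close> without the edge: if the walk avoids
  \<open>(x, y)\<close>, it meets \<open>S\<close>; otherwise it can be cut at \<open>x\<close>.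
  That part meets \<open>T\<close>.\<close>

lemma separates_remove_edge:
  assumes S: "separates (R - {(x, y)}) A B S"
    and T: "separates (R - {(x, y)}) A (insert x S) T"
  shows "separates R A B T"
  unfolding separates_def
proof (intro allI impI)
  fix w assume w: "walk R A B w"
  have "\<exists>w'. walk (R - {(x, y)}) A (insert x S) w' \<and> set w' \<subseteq> set w"
  proof (cases "successively (\<lambda>u v. (u, v) \<in> R - {(x, y)}) w")
    case True
    then have w': "walk (R - {(x, y)}) A B w" using w by (auto simp: walk_def)
    then obtain s where "s \<in> set w" "s \<in> S" using S by (auto simp: separates_def)
    then obtain us vs where "w = us @ s # vs" by (auto simp: in_set_conv_decomp)
    with walk_prefix w' have "walk (R - {(x, y)}) A {s} (us @ [s])" by metis
    then have "walk (R - {(x, y)}) A (insert x S) (us @ [s])"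
      using \<open>s \<in> S\<close> by (auto simp: walk_def)
    then show ?thesis using \<open>w = us @ s # vs\<close> by (intro exI[of _ "us @ [s]"]) auto
  next
    case False
    then obtain us vs where *: "w = us @ x # vs"
      "successively (\<lambda>u v. (u, v) \<in> R - {(x, y)}) (us @ [x])"
      using successively_remove_edge[of R w x y] w unfolding walk_def by blast
    then have "walk (R - {(x, y)}) A (insert x S) (us @ [x])"
      using w by (cases us) (auto simp: walk_def)
    then show ?thesis using * by (intro exI[of _ "us @ [x]"]) auto
  qed
  then show "set w \<inter> T \<noteq> {}" using T unfolding separates_def by blast
qed

lemma separates_remove_edge':
  assumes "separates (R - {(x, y)}) A B S"
    and "separates (R - {(x, y)}) (insert y S) B T"
  shows "separates R A B T"
proof -
  have eq: "(R - {(x, y)})\<inverse> = R\<inverse> - {(y, x)}" by auto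
  have "separates (R\<inverse>) B A T"
    using separates_remove_edge[of "R\<inverse>" y x B A S T] assms
    unfolding eq[symmetric] separates_converse .
  then show ?thesis by (simp add: separates_converse)
qed

text \<open>Following \<open>p\<close> to \<open>v\<close> and then \<open>q\<close> gives a walk
  from \<open>A\<close> to \<open>B\<close>, which must meet \<open>S\<close>. Since
  \<open>p\<close> can meet \<open>S\<close> only in its last vertex \<open>z\<close> and
  \<open>q\<close> only in its first vertex \<open>z'\<close>, no vertex of \<open>S\<close> lies
  before \<open>v\<close> on \<open>p\<close> or after \<open>v\<close> on \<open>q\<close>, so the
  meeting vertex is \<open>v\<close>.\<close>

lemma separates_inter:
  assumes S: "separates R A B S"
    and p: "walk R A {z} p" "distinct p" "set p \<inter> S \<subseteq> {z}"
    and q: "walk R {z'} B q" "distinct q" "set q \<inter> S \<subseteq> {z'}"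
    and v: "v \<in> set p" "v \<in> set q"
  shows "v \<in> S \<and> v = z \<and> v = z'"
proof -
  obtain us us' where p_eq: "p = us @ v # us'" using v(1) by (auto simp: in_set_conv_decomp)
  obtain vs' vs where q_eq: "q = vs' @ v # vs" using v(2) by (auto simp: in_set_conv_decomp)
  have "walk R A B (us @ v # vs)"
    using walk_glue walk_prefix walk_suffix p(1) q(1) unfolding p_eq q_eq by metis
  then obtain s where s: "s \<in> S" "s \<in> set us \<or> s = v \<or> s \<in> set vs"
    using S by (fastforce simp: separates_def)
  have "s \<notin> set us"
  proof
    assume "s \<in> set us"
    then have "z \<in> set us" using s(1) p(3) unfolding p_eq by auto
    moreover have "z \<in> set (v # us')" using p(1) unfolding p_eq walk_def
      by (auto split: if_splits)
    ultimately show False using p(2) unfolding p_eq by auto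
  qed
  moreover have "s \<notin> set vs"
  proof
    assume "s \<in> set vs"
    then have "z' \<in> set vs" using s(1) q(3) unfolding q_eq by auto
    moreover have "z' \<in> set (vs' @ [v])" using q(1) unfolding q_eq walk_def
      by (cases vs') auto
    ultimately show False using q(2) unfolding q_eq by auto
  qed
  ultimately have "v \<in> S" using s by blast
  then show ?thesis using p(3) q(3) v by blast
qed

text \<open>Goering's proof: if deleting the edge \<open>(x, y)\<close> lowers the connectivity, witnessed by a small
  separator \<open>S\<close>, then \<open>A\<close> is linked to \<open>S \<union> {x}\<close> and \<open>S \<union> {y}\<close> is linked to \<open>B\<close> without that
  edge, and the two linkages meet only in \<open>S\<close>.\<close>

theorem menger:
  assumes "finite R" and "finite A"
    and "\<And>T. finite T \<Longrightarrow> separates R A B T \<Longrightarrow> n \<le> card T"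
  shows "linked R A B n"
  using assms
proof (induction R arbitrary: A B rule: finite_psubset_induct)
  case (psubset R)
  show ?case
  proof (cases "R = {}")
    case True
    \<comment> \<open>Without edges every walk is a single vertex, so \<open>A \<inter> B\<close>
      separates; one-vertex paths then form the linkage.\<close>
    have "separates R A B (A \<inter> B)"
      unfolding separates_def walk_def True
    proof (intro allI impI)
      fix w :: "'a list"
      assume "w \<noteq> [] \<and> hd w \<in> A \<and> last w \<in> B \<and> successively (\<lambda>u v. (u, v) \<in> {}) w"
      then show "set w \<inter> (A \<inter> B) \<noteq> {}" by (cases w rule: remdups_adj.cases) auto
    qed
    then have "n \<le> card (A \<inter> B)" using psubset.prems by auto
    then obtain C where C: "C \<subseteq> A \<inter> B" "card C = n" "finite C"
      using obtain_subset_with_card_n by metis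
    show ?thesis
      unfolding linked_def
      by (rule exI[of _ "(\<lambda>c. [c]) ` C"])
        (use C in \<open>auto simp: card_image inj_on_def walk_def pairwise_def vertex_disjoint_def\<close>)
  next
    case False
    then obtain x y where xy: "(x, y) \<in> R" by auto
    define R' where "R' = R - {(x, y)}"
    have R': "R' \<subset> R" using xy by (auto simp: R'_def)
    show ?thesis
    proof (cases "\<forall>T. finite T \<longrightarrow> separates R' A B T \<longrightarrow> n \<le> card T")
      case True
      then have "linked R' A B n" using psubset.IH[OF R' psubset.prems(1)] by blast
      then show ?thesis using R' by (auto intro: linked_mono)
    next
      case False
      then obtain S where S: "finite S" "separates R' A B S" "card S < n" by force
      have sepx: "separates R A B T" if "separates R' A (insert x S) T" for T
        using separates_remove_edge S(2) that unfolding R'_def .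
      have sepy: "separates R A B T" if "separates R' (insert y S) B T" for T
        using separates_remove_edge' S(2) that unfolding R'_def .
      \<comment> \<open>Each of these sets meets every walk ending or starting in it, hence
        separates \<open>A\<close> from \<open>B\<close> in \<open>R\<close> and has at least
        \<open>n\<close> elements. With \<open>card S < n\<close> this forces exactly
        \<open>n\<close> elements and puts \<open>x\<close> and \<open>y\<close> outside
        \<open>S\<close>.\<close>
      have "separates R' A (insert x S) (insert x S)" "separates R' (insert y S) B (insert y S)"
        by (auto simp: separates_def walk_def disjoint_iff)
          (metis last_in_set hd_in_set)+
      then have "n \<le> card (insert x S)" "n \<le> card (insert y S)"
        using sepx sepy psubset.prems(2) S(1) by auto
      then have card: "x \<notin> S" "card (insert x S) = n" "y \<notin> S" "card (insert y S) = n"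
        using S(1,3) by (auto simp: card_insert_if split: if_splits)
      have "linked R' A (insert x S) n"
        using psubset.IH[OF R' psubset.prems(1)] psubset.prems(2) sepx by blast
      from linked_onto[OF this] S(1) card(2) obtain p where
        p: "\<And>z. z \<in> insert x S \<Longrightarrow>
            walk R' A {z} (p z) \<and> distinct (p z) \<and> set (p z) \<inter> insert x S = {z}"
        and p_disj: "\<And>z z'. z \<in> insert x S \<Longrightarrow> z' \<in> insert x S \<Longrightarrow> z \<noteq> z' \<Longrightarrow>
            set (p z) \<inter> set (p z') = {}"
        by (metis finite_insert)
      have "linked R' (insert y S) B n"
        using psubset.IH[OF R', of "insert y S" B] psubset.prems(2) sepy S(1) by blast
      \<comment> \<open>\<open>linked_onto\<close> controls the last vertices of paths, so it is
        applied to the reversed linkage; \<open>rev (q z)\<close> then runs from \<open>z\<close> to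
        \<open>B\<close>.\<close>
      from linked_onto[OF linked_converse[OF this]] S(1) card(4) obtain q where
        q: "\<And>z. z \<in> insert y S \<Longrightarrow>
            walk (R'\<inverse>) B {z} (q z) \<and> distinct (q z) \<and> set (q z) \<inter> insert y S = {z}"
        and q_disj: "\<And>z z'. z \<in> insert y S \<Longrightarrow> z' \<in> insert y S \<Longrightarrow> z \<noteq> z' \<Longrightarrow>
            set (q z) \<inter> set (q z') = {}"
        by (metis finite_insert)
      have q_walk: "walk R' {z} B (rev (q z))" if "z \<in> insert y S" for z
        using q[OF that] walk_rev[of R' B "{z}" "rev (q z)"] by simp
      have meet: "v \<in> S \<and> v = z \<and> v = z'"
        if "z \<in> insert x S" "z' \<in> insert y S" "v \<in> set (p z)" "v \<in> set (q z')" for v z z'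
        by (rule separates_inter[OF S(2), of z "p z" z' "rev (q z')"])
          (use that p q q_walk in auto)
      \<comment> \<open>\<open>t\<close> matches \<open>x\<close> with \<open>y\<close> and fixes
        \<open>S\<close>. The path \<open>r z\<close> runs along \<open>p z\<close> and then
        backwards along \<open>q (t z)\<close>, crossing the edge \<open>(x, y)\<close> if
        \<open>z = x\<close>; otherwise \<open>tl\<close> drops the second copy of
        \<open>z\<close>.\<close>
      define t where "t z = (if z = x then y else z)" for z
      define r where "r z = p z @ (if z = x then rev (q y) else tl (rev (q z)))" for z
      have t: "t z \<in> insert y S" if "z \<in> insert x S" for z
        using that by (auto simp: t_def)
      have r_set: "set (r z) \<subseteq> set (p z) \<union> set (q (t z))" for z
        using set_drop_subset[of 1 "rev (q z)"] by (auto simp: r_def t_def drop_Suc)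
      have r_disj: "set (r z) \<inter> set (r z') = {}"
        if z: "z \<in> insert x S" "z' \<in> insert x S" "z \<noteq> z'" for z z'
      proof -
        have "t z \<noteq> t z'" using z card by (auto simp: t_def)
        then have "set (q (t z)) \<inter> set (q (t z')) = {}" using q_disj t z by blast
        moreover have "set (p z) \<inter> set (q (t z')) = {}"
          using meet[OF z(1) t[OF z(2)]] z card unfolding t_def disjoint_iff by metis
        moreover have "set (p z') \<inter> set (q (t z)) = {}"
          using meet[OF z(2) t[OF z(1)]] z card unfolding t_def disjoint_iff by metis
        ultimately show ?thesis using p_disj[OF z] r_set[of z] r_set[of z'] by blast
      qed
      have r_walk: "walk R A B (r z) \<and> distinct (r z)" if z: "z \<in> insert x S" for z
      proof (cases "z = x")
        case True
        have disj: "set (p x) \<inter> set (q y) = {}" using meet[of x y] card by blast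
        have "walk R A {x} (p x)" "walk R {y} B (rev (q y))"
          using p[of x] q_walk[of y] R' by (auto intro: walk_mono)
        then have "walk R A B (p x @ rev (q y))"
          using xy by (auto simp: walk_def successively_append_iff)
        then show ?thesis using p[of x] q[of y] disj by (simp add: True r_def)
      next
        case False
        then have zS: "z \<in> S" using z by simp
        obtain vs where vs: "rev (q z) = z # vs"
          using q_walk[of z] zS by (cases "rev (q z)") (auto simp: walk_def)
        obtain us where us: "p z = us @ [z]"
          using p[OF z] by (cases "p z" rule: rev_cases) (auto simp: walk_def)
        have r_eq: "r z = us @ z # vs" using False by (simp add: r_def us vs)
        have "walk R' A B (us @ z # vs)"
          using walk_glue[of R' A z us B vs] p[OF z] q_walk[of z] zS us vs by auto
        moreover have "distinct (z # vs)" using q[of z] zS vs by (metis distinct_rev insertCI)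
        moreover have "set us \<inter> set (z # vs) = {}"
        proof -
          have "set (z # vs) = set (q z)" by (metis vs set_rev)
          then show ?thesis using meet[of z z] z zS us p[OF z] by auto
        qed
        ultimately show ?thesis
          using R' p[OF z] unfolding r_eq us by (auto intro: walk_mono)
      qed
      have inj: "inj_on r (insert x S)"
      proof (rule inj_onI)
        fix z z' assume "z \<in> insert x S" "z' \<in> insert x S" "r z = r z'"
        moreover have "r z \<noteq> []" using r_walk[OF \<open>z \<in> _\<close>] by (simp add: walk_def)
        ultimately show "z = z'" using r_disj[of z z'] by fastforce
      qed
      show ?thesis unfolding linked_def
      proof (intro exI[of _ "r ` insert x S"] conjI)
        show "card (r ` insert x S) = n" using card_image[OF inj] card(2) by simp
        show "pairwise vertex_disjoint (r ` insert x S)"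
          using r_disj by (auto simp: pairwise_def vertex_disjoint_def)
      qed (use S(1) r_walk in auto)
    qed
  qed
qed

section \<open>Edges of paths\<close>

lemma path_edges_Nil [simp]: "path_edges [] = {}"
  by (simp add: path_edges_def)

lemma path_edges_Cons:
  "path_edges (u # w) = (if w = [] then {} else insert {u, hd w} (path_edges w))"
proof (cases w)
  case Nil
  then show ?thesis by (simp add: path_edges_def)
next
  case (Cons v w')
  have "e \<in> path_edges (u # w) \<longleftrightarrow> e = {u, v} \<or> e \<in> path_edges w" for e
  proof
    assume "e \<in> path_edges (u # w)"
    then obtain i where "Suc i < length (u # w)" "e = {(u # w) ! i, (u # w) ! Suc i}"
      by (auto simp: path_edges_def)
    then show "e = {u, v} \<or> e \<in> path_edges w"
      by (cases i) (auto simp: path_edges_def Cons)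
  next
    assume "e = {u, v} \<or> e \<in> path_edges w"
    then show "e \<in> path_edges (u # w)"
    proof
      assume "e = {u, v}"
      then show ?thesis unfolding path_edges_def by (auto simp: Cons intro!: exI[of _ 0])
    next
      assume "e \<in> path_edges w"
      then obtain i where "Suc i < length w" "e = {w ! i, w ! Suc i}"
        by (auto simp: path_edges_def)
      then show ?thesis unfolding path_edges_def by (auto intro!: exI[of _ "Suc i"])
    qed
  qed
  then show ?thesis using Cons by auto
qed

text \<open>Transfers the append, reversal and map rules of \<open>successively\<close> to edge sets
  of paths.\<close>

lemma path_edges_subset_iff: "path_edges p \<subseteq> F \<longleftrightarrow> successively (\<lambda>u v. {u, v} \<in> F) p"
  by (induction p) (auto simp: path_edges_Cons successively_Cons)

lemma path_edges_rev [simp]: "path_edges (rev p) = path_edges p"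
proof -
  have "path_edges (rev q) \<subseteq> path_edges q" for q :: "'a list"
  proof -
    have "successively (\<lambda>u v. {u, v} \<in> path_edges q) q"
      unfolding path_edges_subset_iff[symmetric] by (rule order_refl)
    then show ?thesis unfolding path_edges_subset_iff by (simp add: insert_commute)
  qed
  from this[of p] this[of "rev p"] show ?thesis by auto
qed

lemma path_edges_verts: "e \<in> path_edges p \<Longrightarrow> e \<subseteq> set p"
  by (induction p) (auto simp: path_edges_Cons split: if_splits)

lemma path_edges_suffix:
  assumes "e \<in> path_edges (us @ vs)" "e \<subseteq> set vs" "set us \<inter> set vs = {}"
  shows "e \<in> path_edges vs"
  using assms by (induction us) (auto simp: path_edges_Cons split: if_splits)

text \<open>A segment of a path is induced in it: the prefix is stripped first, then the suffix, by
  the same rule on the reversed list.\<close>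

lemma path_edges_infix:
  assumes "e \<in> path_edges (us @ p @ vs)" "e \<subseteq> set p" "distinct (us @ p @ vs)"
  shows "e \<in> path_edges p"
proof -
  have "e \<in> path_edges (p @ vs)"
    using path_edges_suffix[of e us "p @ vs"] assms by auto
  then have "e \<in> path_edges (rev vs @ rev p)"
    using path_edges_rev[of "p @ vs"] by simp
  then have "e \<in> path_edges (rev p)"
    using path_edges_suffix[of e "rev vs" "rev p"] assms by auto
  then show ?thesis by simp
qed

lemma path_edges_infix_subset: "path_edges p \<subseteq> path_edges (us @ p @ vs)"
  using path_edges_subset_iff[of "us @ p @ vs" "path_edges (us @ p @ vs)"]
  by (auto simp: path_edges_subset_iff successively_append_iff)

section \<open>Degrees of vertices in a path\<close>

definition nbrs :: "'a list \<Rightarrow> 'a \<Rightarrow> 'a set" where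
  "nbrs p a = {c. {a, c} \<in> path_edges p}"

lemma finite_nbrs: "finite (nbrs p a)"
  by (rule finite_subset[of _ "set p"]) (auto simp: nbrs_def dest: path_edges_verts)

lemma card_nbrs:
  assumes "distinct p" "i < length p"
  shows "card (nbrs p (p ! i)) = of_bool (0 < i) + of_bool (Suc i < length p)"
proof -
  \<comment> \<open>The neighbours are the entries just before and just after position
    \<open>i\<close>; the guard \<open>0 < i\<close> matters because \<open>i - 1\<close> is 0 for
    \<open>i = 0\<close>.\<close>
  have "c \<in> nbrs p (p ! i) \<longleftrightarrow> 0 < i \<and> c = p ! (i - 1) \<or> Suc i < length p \<and> c = p ! Suc i"
    for c
  proof
    assume "c \<in> nbrs p (p ! i)"
    then obtain j where j: "Suc j < length p" "{p ! i, c} = {p ! j, p ! Suc j}"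
      by (auto simp: nbrs_def path_edges_def)
    then have "p ! i = p ! j \<and> c = p ! Suc j \<or> p ! i = p ! Suc j \<and> c = p ! j"
      by (auto simp: doubleton_eq_iff)
    then show "0 < i \<and> c = p ! (i - 1) \<or> Suc i < length p \<and> c = p ! Suc i"
      using assms j(1) by (auto simp: nth_eq_iff_index_eq)
  next
    assume "0 < i \<and> c = p ! (i - 1) \<or> Suc i < length p \<and> c = p ! Suc i"
    then show "c \<in> nbrs p (p ! i)"
    proof
      assume "0 < i \<and> c = p ! (i - 1)"
      then show ?thesis using assms unfolding nbrs_def path_edges_def
        by (auto simp: insert_commute intro!: exI[of _ "i - 1"])
    qed (auto simp: nbrs_def path_edges_def)
  qed
  then have "nbrs p (p ! i) =
      (if 0 < i then {p ! (i - 1)} else {}) \<union> (if Suc i < length p then {p ! Suc i} else {})"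
    by auto
  moreover have "p ! (i - 1) \<noteq> p ! Suc i" if "0 < i" "Suc i < length p"
    using assms that by (auto simp: nth_eq_iff_index_eq)
  ultimately show ?thesis by auto
qed

section \<open>Tight paths\<close>

text \<open>In contrast to \<open>is_XY_path\<close>, the orientation is fixed from \<open>X\<close>
  to \<open>Y\<close>. A single vertex of \<open>X \<inter> Y\<close> is tight.\<close>

definition tight_path :: "'a set \<Rightarrow> 'a set \<Rightarrow> 'a list \<Rightarrow> bool" where
  "tight_path X Y p \<longleftrightarrow> p \<noteq> [] \<and> distinct p \<and> set p \<inter> X = {hd p} \<and> set p \<inter> Y = {last p}"

text \<open>Take the segment from the last vertex in \<open>X\<close> to the first vertex in
  \<open>Y\<close> at or after it. Being a segment, it is induced in \<open>p\<close>, so shortening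
  turns no edge of \<open>p\<close> into a chord.\<close>

lemma tight_subpath:
  assumes p: "p \<noteq> []" "distinct p" "hd p \<in> X" "last p \<in> Y"
  obtains q where "tight_path X Y q" "set q \<subseteq> set p" "path_edges q \<subseteq> path_edges p"
    "\<And>e. e \<in> path_edges p \<Longrightarrow> e \<subseteq> set q \<Longrightarrow> e \<in> path_edges q"
proof -
  have "\<exists>x\<in>set p. x \<in> X" using p by auto
  then obtain us x vs where 1: "p = us @ x # vs" "x \<in> X" "\<forall>z\<in>set vs. z \<notin> X"
    by (rule split_list_last_propE)
  have "last (x # vs) \<in> Y" using p(4) 1(1) by simp
  then have "\<exists>y\<in>set (x # vs). y \<in> Y" using last_in_set by blast
  then obtain ys y zs where 2: "x # vs = ys @ y # zs" "y \<in> Y" "\<forall>z\<in>set ys. z \<notin> Y"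
    by (rule split_list_first_propE)
  define q where "q = ys @ [y]"
  have p_eq: "p = us @ q @ zs" using 1(1) 2(1) by (simp add: q_def)
  have hd_q: "hd q = x" using 2(1) unfolding q_def by (cases ys) auto
  have "set q \<subseteq> insert x (set vs)"
    using arg_cong[OF 2(1), of set] by (auto simp: q_def)
  then have "set q \<inter> X = {hd q}"
    using 1(2,3) hd_q hd_in_set[of q] by (auto simp: q_def)
  moreover have "set q \<inter> Y = {last q}" using 2 by (auto simp: q_def)
  ultimately have "tight_path X Y q"
    using p(2) unfolding tight_path_def p_eq by (auto simp: q_def)
  then show ?thesis
    using that[of q] path_edges_infix_subset path_edges_infix p(2) unfolding p_eq
    by (metis Un_upper1 Un_upper2 order_trans set_append)
qed

text \<open>A neighbour is missing only at an end of a path. If \<open>a\<close> is the first vertex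
  of \<open>q\<close>, it lies in \<open>X\<close>, so by tightness it is the first vertex of
  \<open>p\<close>, and likewise for last vertices. So \<open>p\<close> lacks a neighbour of
  \<open>a\<close> on every side where \<open>q\<close> does.\<close>

lemma nbrs_card_le:
  assumes p: "tight_path X Y p" and q: "distinct q" "hd q \<in> X" "last q \<in> Y"
    and a: "a \<in> set p" "a \<in> set q"
  shows "card (nbrs p a) \<le> card (nbrs q a)"
proof -
  obtain i where i: "i < length p" "p ! i = a" using a(1) by (auto simp: in_set_conv_nth)
  obtain j where j: "j < length q" "q ! j = a" using a(2) by (auto simp: in_set_conv_nth)
  have dp: "distinct p" "p \<noteq> []" using p by (auto simp: tight_path_def)
  have "i = 0" if "j = 0"
  proof -
    have "hd q = a" using that j by (cases q) auto
    then have "a = hd p" using q(2) p a(1) by (auto simp: tight_path_def)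
    then have "p ! i = p ! 0" using dp i by (simp add: hd_conv_nth)
    then show ?thesis using dp i by (simp add: nth_eq_iff_index_eq)
  qed
  moreover have "Suc i = length p" if "Suc j = length q"
  proof -
    have "last q = a" using that j last_conv_nth[of q]
      by (metis diff_Suc_1 length_0_conv nat.distinct(1))
    then have "a = last p" using q(3) p a(1) by (auto simp: tight_path_def)
    then have "p ! i = p ! (length p - 1)" using dp i by (simp add: last_conv_nth)
    then show ?thesis using dp i by (simp add: nth_eq_iff_index_eq)
  qed
  ultimately have "of_bool (0 < i) + of_bool (Suc i < length p) \<le>
      (of_bool (0 < j) + of_bool (Suc j < length q) :: nat)"
    using i(1) j(1) by (intro add_mono) (auto intro: Suc_lessI)
  then show ?thesis using card_nbrs[OF dp(1) i(1)] card_nbrs[OF q(1) j(1)] i(2) j(2) by simp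
qed

section \<open>Contracting a matching\<close>

text \<open>The fibres in \<open>ws\<close> are traversed one by one: each step of \<open>R\<close>
  comes from an edge of \<open>F\<close>, and if the vertex entering a fibre differs from the one
  leaving it, an edge of \<open>N\<close> joins them. Prescribing the entry vertex \<open>a\<close>
  makes the induction work. As \<open>ws\<close> is distinct, each fibre is entered once, so two
  vertices of one fibre on \<open>q\<close> are consecutive.\<close>

lemma lift_path:
  fixes f :: "'a \<Rightarrow> 'b"
  assumes R: "\<And>w w'. (w, w') \<in> R \<Longrightarrow> \<exists>u u'. f u = w \<and> f u' = w' \<and> {u, u'} \<in> F"
    and N: "\<And>u v. f u = f v \<Longrightarrow> u \<noteq> v \<Longrightarrow> {u, v} \<in> N"
    and "ws \<noteq> []" "distinct ws" "successively (\<lambda>u v. (u, v) \<in> R) ws"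
    and "last ws \<in> f ` B" "f a = hd ws"
  shows "\<exists>q. q \<noteq> [] \<and> hd q = a \<and> last q \<in> B \<and> distinct q \<and> path_edges q \<subseteq> F \<union> N \<and>
    f ` set q \<subseteq> set ws \<and> set q \<subseteq> insert a (B \<union> \<Union>F) \<and>
    (\<forall>u\<in>set q. \<forall>v\<in>set q. u \<noteq> v \<longrightarrow> f u = f v \<longrightarrow> {u, v} \<in> path_edges q)"
  using assms(3-)
proof (induction ws arbitrary: a)
  case Nil
  then show ?case by simp
next
  case (Cons w ws)
  show ?case
  proof (cases "ws = []")
    case True
    then obtain b where b: "b \<in> B" "f b = w" using Cons.prems by auto
    have fa: "f a = w" using Cons.prems by simp
    show ?thesis
    proof (cases "a = b")
      case True
      then show ?thesis using b fa by (intro exI[of _ "[a]"]) (auto simp: path_edges_Cons)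
    next
      case False
      then have "{a, b} \<in> N" using N b fa by simp
      then show ?thesis using b fa False
        by (intro exI[of _ "[a, b]"]) (auto simp: path_edges_Cons insert_commute)
    qed
  next
    case False
    then have ws: "(w, hd ws) \<in> R" "successively (\<lambda>u v. (u, v) \<in> R) ws" "distinct ws"
      "last ws \<in> f ` B" "w \<notin> set ws" and fa: "f a = w"
      using Cons.prems by (auto simp: successively_Cons)
    obtain u u' where u: "f u = w" "f u' = hd ws" "{u, u'} \<in> F" using R[OF ws(1)] by blast
    obtain q where q: "q \<noteq> []" "hd q = u'" "last q \<in> B" "distinct q" "path_edges q \<subseteq> F \<union> N"
      "f ` set q \<subseteq> set ws" "set q \<subseteq> insert u' (B \<union> \<Union>F)"
      "\<forall>u\<in>set q. \<forall>v\<in>set q. u \<noteq> v \<longrightarrow> f u = f v \<longrightarrow> {u, v} \<in> path_edges q"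
      using Cons.IH[OF False ws(3,2,4) u(2)] by blast
    have new: "\<forall>v\<in>set q. f v \<noteq> w \<and> w \<noteq> f v" using q(6) ws(5) by auto
    have sub: "set q \<subseteq> insert a (B \<union> \<Union>F)" "u \<in> insert a (B \<union> \<Union>F)" using q(7) u(3) by auto
    show ?thesis
    proof (cases "a = u")
      case True
      then show ?thesis using q u fa new sub
        by (intro exI[of _ "a # q"]) (auto simp: path_edges_Cons)
    next
      case False
      then have "{a, u} \<in> N" using N u fa by simp
      then show ?thesis using q u fa new sub False
        by (intro exI[of _ "a # u # q"]) (auto simp: path_edges_Cons insert_commute)
    qed
  qed
qed

text \<open>Half of the paths pay for absorbing \<open>N\<close>. The last conclusion is the point:
  on the new vertex set, neither \<open>N\<close> nor the old paths leave a non-path edge.\<close>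

lemma halve_linkage:
  assumes E: "\<forall>e\<in>E. card e = 2"
    and P: "finite P" "card P = 2 * n" "\<forall>p\<in>P. tight_path X Y p" "pairwise vertex_disjoint P"
      "paths_edges P \<subseteq> E"
    and N: "induced_matching E N"
  obtains Q where "finite Q" "card Q = n" "pairwise vertex_disjoint Q"
    "\<And>q. q \<in> Q \<Longrightarrow> q \<noteq> [] \<and> distinct q \<and> hd q \<in> X \<and> last q \<in> Y \<and>
      set q \<subseteq> paths_verts P \<and> path_edges q \<subseteq> paths_edges P \<union> N"
    "\<And>e. e \<in> paths_edges P \<union> N \<Longrightarrow> e \<subseteq> paths_verts Q \<Longrightarrow> e \<in> paths_edges Q"
proof -
  define U where "U = paths_verts P"
  define F where "F = paths_edges P"
  \<comment> \<open>\<open>f u\<close> is the class of \<open>u\<close> in the contraction: its edge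
    of \<open>N\<close> if there is one, otherwise \<open>{u}\<close>. \<open>R\<close> consists of
    the images of the path edges, in both directions.\<close>
  define f where "f u = insert u (\<Union>{e \<in> N. u \<in> e})" for u
  define R where "R = {(f u, f v) | u v. {u, v} \<in> F}"
  have finU: "finite U" using P(1) by (auto simp: U_def paths_verts_def)
  have FU: "\<Union>F \<subseteq> U"
    using path_edges_verts by (fastforce simp: F_def U_def paths_edges_def paths_verts_def)
  have P_disj: "p = q" if "p \<in> P" "q \<in> P" "v \<in> set p" "v \<in> set q" for p q v
    using P(4) that by (auto simp: pairwise_def vertex_disjoint_def)
  have N_E: "N \<subseteq> E" using N by (simp add: induced_matching_def)
  have N_eq: "e = e'" if "e \<in> N" "e' \<in> N" "u \<in> e" "u \<in> e'" for e e' u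
    using N that unfolding induced_matching_def by blast
  have f_edge: "f u = e" if "e \<in> N" "u \<in> e" for e u
    using that N_eq by (auto simp: f_def)
  have f_N: "{u, v} \<in> N" if uv: "f u = f v" "u \<noteq> v" for u v
  proof -
    have "v \<in> f u" unfolding uv(1) by (simp add: f_def)
    then obtain e where e: "e \<in> N" "u \<in> e" "v \<in> e" using uv(2) by (auto simp: f_def)
    then have "card e = 2" using N_E E by auto
    then have "e = {u, v}" using e uv(2) by (auto simp: card_2_iff)
    then show ?thesis using e by simp
  qed
  have fibre: "finite {u. f u = t} \<and> card {u. f u = t} \<le> 2" for t
  proof (cases "\<exists>u. f u = t")
    case True
    then obtain u where u: "f u = t" by blast
    have "finite t \<and> card t \<le> 2"
    proof (cases "\<exists>e\<in>N. u \<in> e")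
      case True
      then have "t \<in> N" using f_edge u by blast
      then have "card t = 2" using N_E E by auto
      \<comment> \<open>\<open>card\<close> is 0 on infinite sets, so the value 2 also yields
        finiteness.\<close>
      then show ?thesis by (metis card.infinite order_refl zero_neq_numeral)
    next
      case False
      then have "t = {u}" using u unfolding f_def by blast
      then show ?thesis by simp
    qed
    moreover have "{u. f u = t} \<subseteq> t" by (auto simp: f_def)
    ultimately show ?thesis by (meson card_mono finite_subset order_trans)
  qed auto
  have "R \<subseteq> f ` U \<times> f ` U" using FU unfolding R_def by blast
  then have finR: "finite R" using finU finite_subset by blast
  have "linked R (f ` (X \<inter> U)) (f ` (Y \<inter> U)) n"
  proof (rule menger[OF finR])
    show "finite (f ` (X \<inter> U))" using finU by simp
  next
    fix T assume T: "finite T" "separates R (f ` (X \<inter> U)) (f ` (Y \<inter> U)) T"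
    \<comment> \<open>The image of each old path is a walk in the contraction, possibly with
      repetitions, so it meets \<open>T\<close>.\<close>
    have "\<exists>v. v \<in> set p \<and> f v \<in> T" if p: "p \<in> P" for p
    proof -
      have tp: "tight_path X Y p" using P p by blast
      have "set p \<subseteq> U" using p by (auto simp: U_def paths_verts_def)
      moreover have "path_edges p \<subseteq> F" using p by (auto simp: F_def paths_edges_def)
      then have "successively (\<lambda>u v. (f u, f v) \<in> R) p"
        unfolding path_edges_subset_iff by (rule successively_mono) (auto simp: R_def)
      ultimately have "walk R (f ` (X \<inter> U)) (f ` (Y \<inter> U)) (map f p)"
        using tp unfolding walk_def tight_path_def
        by (auto simp: hd_map last_map successively_map)
      then show ?thesis using T(2) by (fastforce simp: separates_def)
    qed
    then obtain g where g: "\<And>p. p \<in> P \<Longrightarrow> g p \<in> set p \<and> f (g p) \<in> T" by metis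
    have inj: "inj_on g P" using g P_disj by (metis inj_onI)
    \<comment> \<open>The chosen vertices are distinct and lie in the fibres over \<open>T\<close>,
      each of size at most 2, so \<open>2 * n \<le> 2 * card T\<close>.\<close>
    have "g ` P \<subseteq> (\<Union>t\<in>T. {u. f u = t})" using g by auto
    then have "card (g ` P) \<le> card (\<Union>t\<in>T. {u. f u = t})"
      using T(1) fibre by (intro card_mono) auto
    also have "\<dots> \<le> (\<Sum>t\<in>T. card {u. f u = t})" by (rule card_UN_le[OF T(1)])
    also have "\<dots> \<le> (\<Sum>t\<in>T. 2)" using fibre by (intro sum_mono) auto
    finally show "n \<le> card T" using card_image[OF inj] P(2) by simp
  qed
  then obtain L where L: "finite L" "card L = n" "pairwise vertex_disjoint L"
    "\<And>ws. ws \<in> L \<Longrightarrow> walk R (f ` (X \<inter> U)) (f ` (Y \<inter> U)) ws \<and> distinct ws"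
    by (auto simp: linked_def)
  have "\<exists>q. q \<noteq> [] \<and> distinct q \<and> hd q \<in> X \<and> last q \<in> Y \<and> set q \<subseteq> U \<and>
      path_edges q \<subseteq> F \<union> N \<and> f ` set q \<subseteq> set ws \<and>
      (\<forall>u\<in>set q. \<forall>v\<in>set q. u \<noteq> v \<longrightarrow> f u = f v \<longrightarrow> {u, v} \<in> path_edges q)"
    if "ws \<in> L" for ws
  proof -
    from L(4)[OF that] have ws: "ws \<noteq> []" "distinct ws" "successively (\<lambda>u v. (u, v) \<in> R) ws"
      "last ws \<in> f ` (Y \<inter> U)" "hd ws \<in> f ` (X \<inter> U)" by (auto simp: walk_def)
    then obtain a where a: "a \<in> X" "a \<in> U" "f a = hd ws" by auto
    have "\<exists>u u'. f u = w \<and> f u' = w' \<and> {u, u'} \<in> F" if "(w, w') \<in> R" for w w'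
      using that by (auto simp: R_def)
    from lift_path[of R f F N, OF this f_N ws(1-4) a(3)] obtain q where
      "q \<noteq> []" "hd q = a" "last q \<in> Y \<inter> U" "distinct q" "path_edges q \<subseteq> F \<union> N"
      "f ` set q \<subseteq> set ws" "set q \<subseteq> insert a (Y \<inter> U \<union> \<Union>F)"
      "\<forall>u\<in>set q. \<forall>v\<in>set q. u \<noteq> v \<longrightarrow> f u = f v \<longrightarrow> {u, v} \<in> path_edges q"
      by blast
    moreover from this have "set q \<subseteq> U" using a FU by blast
    ultimately show ?thesis using a by (intro exI[of _ q]) auto
  qed
  then obtain l where l: "\<And>ws. ws \<in> L \<Longrightarrow> l ws \<noteq> [] \<and> distinct (l ws) \<and> hd (l ws) \<in> X \<and>
      last (l ws) \<in> Y \<and> set (l ws) \<subseteq> U \<and> path_edges (l ws) \<subseteq> F \<union> N \<and> f ` set (l ws) \<subseteq> set ws"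
    and l_fibre: "\<And>ws u v. ws \<in> L \<Longrightarrow> u \<in> set (l ws) \<Longrightarrow> v \<in> set (l ws) \<Longrightarrow> u \<noteq> v \<Longrightarrow>
      f u = f v \<Longrightarrow> {u, v} \<in> path_edges (l ws)"
    by metis
  \<comment> \<open>The lifted paths are disjoint even up to contraction. With \<open>u = v\<close>
    this is disjointness; for the ends of an edge of \<open>N\<close> it puts both on one
    path.\<close>
  have same: "ws = ws'" if "ws \<in> L" "ws' \<in> L" "u \<in> set (l ws)" "v \<in> set (l ws')" "f u = f v"
    for ws ws' u v
  proof -
    have "f u \<in> set ws" "f u \<in> set ws'" using l that by (metis image_subset_iff)+
    then show ?thesis using L(3) that by (auto simp: pairwise_def vertex_disjoint_def)
  qed
  have inj: "inj_on l L"
  proof (rule inj_onI)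
    fix ws ws' assume *: "ws \<in> L" "ws' \<in> L" "l ws = l ws'"
    then have "hd (l ws) \<in> set (l ws)" "hd (l ws) \<in> set (l ws')" using l by auto
    then show "ws = ws'" using same * by blast
  qed
  text \<open>By tightness, a vertex has at least as many neighbours on its new path as on its old one,
    so a vertex that loses an old edge gains an edge of the matching.\<close>
  have gain: "\<exists>c. {a, c} \<in> N \<and> {a, c} \<in> path_edges (l ws)"
    if ws: "ws \<in> L" "a \<in> set (l ws)" and ab: "{a, b} \<in> F" "{a, b} \<notin> path_edges (l ws)" for a b ws
  proof (rule ccontr)
    assume no: "\<not> ?thesis"
    obtain p where p: "p \<in> P" "{a, b} \<in> path_edges p"
      using ab(1) by (auto simp: F_def paths_edges_def)
    then have ap: "a \<in> set p" using path_edges_verts by fastforce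
    \<comment> \<open>Every edge at \<open>a\<close> on the new path is then in \<open>F\<close>,
      and \<open>p\<close> is the only old path through \<open>a\<close>.\<close>
    have "c \<in> nbrs p a" if "c \<in> nbrs (l ws) a" for c
    proof -
      have "{a, c} \<in> path_edges (l ws)" using that by (simp add: nbrs_def)
      then have "{a, c} \<in> F" using l[OF ws(1)] no by blast
      then obtain p' where p': "p' \<in> P" "{a, c} \<in> path_edges p'"
        by (auto simp: F_def paths_edges_def)
      then have "a \<in> set p'" using path_edges_verts by fastforce
      then have "p' = p" using P_disj p p' ap by blast
      then show ?thesis using p' by (simp add: nbrs_def)
    qed
    moreover have "b \<in> nbrs p a" "b \<notin> nbrs (l ws) a" using p ab by (auto simp: nbrs_def)
    ultimately have "nbrs (l ws) a \<subset> nbrs p a" by blast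
    then have "card (nbrs (l ws) a) < card (nbrs p a)"
      by (rule psubset_card_mono[OF finite_nbrs])
    moreover have "card (nbrs p a) \<le> card (nbrs (l ws) a)"
      using P(3) p(1) l[OF ws(1)] ap ws(2) by (intro nbrs_card_le[of X Y]) auto
    ultimately show False by simp
  qed
  show ?thesis
  proof (rule that[of "l ` L"])
    show "finite (l ` L)" "card (l ` L) = n" using L card_image[OF inj] by auto
    show "pairwise vertex_disjoint (l ` L)"
      unfolding pairwise_def vertex_disjoint_def disjoint_iff using same by blast
  next
    fix q assume "q \<in> l ` L"
    then obtain ws where "ws \<in> L" "q = l ws" by blast
    then show "q \<noteq> [] \<and> distinct q \<and> hd q \<in> X \<and> last q \<in> Y \<and>
      set q \<subseteq> paths_verts P \<and> path_edges q \<subseteq> paths_edges P \<union> N"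
      using l[of ws] by (simp add: U_def F_def)
  next
    fix e assume e: "e \<in> paths_edges P \<union> N" "e \<subseteq> paths_verts (l ` L)"
    then have "e \<in> E" using N_E P(5) by blast
    then obtain a b where ab: "e = {a, b}" "a \<noteq> b" using E by (auto simp: card_2_iff)
    obtain ws ws' where ws: "ws \<in> L" "a \<in> set (l ws)" "ws' \<in> L" "b \<in> set (l ws')"
      using e(2) ab by (auto simp: paths_verts_def)
    show "e \<in> paths_edges (l ` L)"
    proof (rule ccontr)
      assume lost: "e \<notin> paths_edges (l ` L)"
      have "e \<notin> N"
      proof
        assume "e \<in> N"
        \<comment> \<open>Both ends of an edge of \<open>N\<close> have the same class, so they lie
          on one lifted path, where the lifting made them consecutive.\<close>
        then have "f a = f b" using f_edge[of e] ab by auto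
        moreover from this have "ws = ws'" using same ws by blast
        ultimately have "e \<in> path_edges (l ws)" using l_fibre ws ab by blast
        then show False using lost ws by (auto simp: paths_edges_def)
      qed
      then have "e \<in> F" using e(1) by (simp add: F_def)
      moreover have "e \<notin> path_edges (l ws)" "e \<notin> path_edges (l ws')"
        using lost ws by (auto simp: paths_edges_def)
      \<comment> \<open>The ends \<open>a\<close> and \<open>b\<close> may lie on different new
        paths, but each loses the edge \<open>e\<close> and so gains an edge of \<open>N\<close>.
        These two edges are distinct because \<open>e\<close> is not in \<open>N\<close>, and
        \<open>e\<close> joins them.\<close>
      ultimately obtain c d where c: "{a, c} \<in> N" and d: "{b, d} \<in> N"
        using gain[OF ws(1,2), of b] gain[OF ws(3,4), of a] ab by (auto simp: insert_commute)
      have "{a, c} \<noteq> {b, d}"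
      proof
        assume "{a, c} = {b, d}"
        then have "{a, c} = e" using ab by (auto simp: doubleton_eq_iff)
        then show False using c \<open>e \<notin> N\<close> by simp
      qed
      then have "\<forall>u\<in>{a, c}. \<forall>v\<in>{b, d}. {u, v} \<notin> E"
        using N[unfolded induced_matching_def, THEN conjunct2, rule_format, OF c d] by simp
      then have "{a, b} \<notin> E" by simp
      then show False using \<open>e \<in> E\<close> ab by simp
    qed
  qed
qed

section \<open>Tight linkages and the induction on the number of matchings\<close>

lemma tighten_linkage:
  assumes "finite P" "\<forall>p\<in>P. is_XY_path V E X Y p" "pairwise vertex_disjoint P"
  obtains Q where "finite Q" "card Q = card P" "\<forall>q\<in>Q. tight_path X Y q \<and> is_XY_path V E X Y q"
    "pairwise vertex_disjoint Q" "paths_verts Q \<subseteq> paths_verts P"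
    "\<And>e. e \<in> paths_edges P \<Longrightarrow> e \<subseteq> paths_verts Q \<Longrightarrow> e \<in> paths_edges Q"
proof -
  have "\<exists>q. tight_path X Y q \<and> set q \<subseteq> set p \<and> path_edges q \<subseteq> path_edges p \<and>
      (\<forall>e. e \<in> path_edges p \<longrightarrow> e \<subseteq> set q \<longrightarrow> e \<in> path_edges q)" if "p \<in> P" for p
  proof -
    \<comment> \<open>A path running from \<open>Y\<close> to \<open>X\<close> is reversed first,
      which keeps its vertices and edges.\<close>
    have p: "p \<noteq> []" "distinct p" "hd p \<in> X \<and> last p \<in> Y \<or> hd (rev p) \<in> X \<and> last (rev p) \<in> Y"
      using assms(2) that by (auto simp: is_XY_path_def is_path_def hd_rev last_rev)
    from p(3) show ?thesis
    proof
      assume "hd p \<in> X \<and> last p \<in> Y"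
      then show ?thesis using tight_subpath[of p X Y] p by metis
    next
      assume "hd (rev p) \<in> X \<and> last (rev p) \<in> Y"
      then show ?thesis using tight_subpath[of "rev p" X Y] p
        by (metis distinct_rev path_edges_rev rev_is_Nil_conv set_rev)
    qed
  qed
  then obtain g where g: "\<And>p. p \<in> P \<Longrightarrow> tight_path X Y (g p) \<and> set (g p) \<subseteq> set p \<and>
      path_edges (g p) \<subseteq> path_edges p"
    and g_edges: "\<And>p e. p \<in> P \<Longrightarrow> e \<in> path_edges p \<Longrightarrow> e \<subseteq> set (g p) \<Longrightarrow> e \<in> path_edges (g p)"
    by metis
  have disj: "p = q" if "p \<in> P" "q \<in> P" "v \<in> set p" "v \<in> set q" for p q v
    using assms(3) that by (auto simp: pairwise_def vertex_disjoint_def)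
  have inj: "inj_on g P"
  proof (rule inj_onI)
    fix p q assume *: "p \<in> P" "q \<in> P" "g p = g q"
    then have "hd (g p) \<in> set (g p)" using g by (auto simp: tight_path_def)
    then show "p = q" using disj[of p q] g * by (metis subsetD)
  qed
  show ?thesis
  proof (rule that[of "g ` P"])
    show "finite (g ` P)" "card (g ` P) = card P" using assms(1) card_image[OF inj] by auto
    show "pairwise vertex_disjoint (g ` P)"
      using g disj unfolding pairwise_def vertex_disjoint_def by fastforce
    show "paths_verts (g ` P) \<subseteq> paths_verts P" using g by (fastforce simp: paths_verts_def)
    show "\<forall>q\<in>g ` P. tight_path X Y q \<and> is_XY_path V E X Y q"
    proof
      fix q assume "q \<in> g ` P"
      then obtain p where p: "p \<in> P" "q = g p" by blast
      have "is_path V E p" using assms(2) p by (auto simp: is_XY_path_def)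
      then have "is_path V E q" using g[OF p(1)] p(2) by (auto simp: is_path_def tight_path_def)
      then show "tight_path X Y q \<and> is_XY_path V E X Y q"
        using g[OF p(1)] p(2) by (auto simp: is_XY_path_def tight_path_def)
    qed
  next
    fix e assume e: "e \<in> paths_edges P" "e \<subseteq> paths_verts (g ` P)"
    then obtain p where p: "p \<in> P" "e \<in> path_edges p" by (auto simp: paths_edges_def)
    \<comment> \<open>The end \<open>v\<close> survives on some shortened path \<open>g p'\<close>;
      as \<open>v\<close> also lies on \<open>p\<close>, disjointness gives
      \<open>p' = p\<close>.\<close>
    have "v \<in> set (g p)" if v: "v \<in> e" for v
    proof -
      obtain p' where p': "p' \<in> P" "v \<in> set (g p')" using e(2) v by (auto simp: paths_verts_def)
      moreover have "v \<in> set p" using path_edges_verts[OF p(2)] v by blast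
      ultimately show ?thesis using disj[of p p' v] g p by auto
    qed
    then show "e \<in> paths_edges (g ` P)" using g_edges[OF p] p(1) by (auto simp: paths_edges_def)
  qed
qed

text \<open>A cover of the induced edges, rather than a partition of the non-path edges, is what the
  induction preserves: on a smaller vertex set a matching \<open>M i\<close> may have edges that
  leave it.\<close>

lemma nonadjacent_paths_of_cover:
  assumes "finite_graph V E"
    and "finite P" "card P = 2 ^ m * k" "\<forall>p\<in>P. is_XY_path V E X Y p"
      "pairwise vertex_disjoint P"
    and "\<forall>i<m. induced_matching E (M i)"
    and "induced_edges E (paths_verts P) \<subseteq> paths_edges P \<union> (\<Union>i<m. M i)"
  shows "\<exists>Q. finite Q \<and> card Q = k \<and> (\<forall>q\<in>Q. is_XY_path V E X Y q) \<and>
           pairwise (non_adjacent E) Q"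
  using assms(2-)
proof (induction m arbitrary: P)
  case 0
  have disj: "p = q" if "p \<in> P" "q \<in> P" "v \<in> set p" "v \<in> set q" for p q v
    using 0(4) that by (auto simp: pairwise_def vertex_disjoint_def)
  \<comment> \<open>With no matchings left, every edge induced on the paths is a path edge and so
    stays within one path.\<close>
  have "{u, v} \<notin> E" if "p \<in> P" "q \<in> P" "p \<noteq> q" "u \<in> set p" "v \<in> set q" for p q u v
  proof
    assume "{u, v} \<in> E"
    then have "{u, v} \<in> induced_edges E (paths_verts P)"
      using that by (auto simp: induced_edges_def paths_verts_def)
    then have "{u, v} \<in> paths_edges P" using 0(6) by auto
    then obtain r where r: "r \<in> P" "{u, v} \<in> path_edges r" by (auto simp: paths_edges_def)
    then have "u \<in> set r" "v \<in> set r" using path_edges_verts by fastforce+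
    then show False using disj r(1) that by metis
  qed
  then have "pairwise (non_adjacent E) P"
    using 0(4) by (auto simp: pairwise_def non_adjacent_def)
  then show ?case using 0 by auto
next
  case (Suc m)
  have E: "\<forall>e\<in>E. card e = 2" using assms(1) by (simp add: finite_graph_def)
  obtain P' where P': "finite P'" "card P' = card P"
    "\<forall>q\<in>P'. tight_path X Y q \<and> is_XY_path V E X Y q"
    "pairwise vertex_disjoint P'" "paths_verts P' \<subseteq> paths_verts P"
    "\<And>e. e \<in> paths_edges P \<Longrightarrow> e \<subseteq> paths_verts P' \<Longrightarrow> e \<in> paths_edges P'"
    using tighten_linkage[OF Suc.prems(1,3,4)] by metis
  have P'_E: "paths_edges P' \<subseteq> E"
    using P'(3) by (auto simp: paths_edges_def is_XY_path_def is_path_def)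
  have P'_V: "paths_verts P' \<subseteq> V"
    using P'(3) by (auto simp: paths_verts_def is_XY_path_def is_path_def)
  have M: "induced_matching E (M m)" using Suc.prems(5) by simp
  have "card P' = 2 * (2 ^ m * k)" using P'(2) Suc.prems(2) by simp
  from halve_linkage[OF E P'(1) this _ P'(4) P'_E M] P'(3)
  obtain Q where Q: "finite Q" "card Q = 2 ^ m * k" "pairwise vertex_disjoint Q"
    "\<And>q. q \<in> Q \<Longrightarrow> q \<noteq> [] \<and> distinct q \<and> hd q \<in> X \<and> last q \<in> Y \<and>
      set q \<subseteq> paths_verts P' \<and> path_edges q \<subseteq> paths_edges P' \<union> M m"
    "\<And>e. e \<in> paths_edges P' \<union> M m \<Longrightarrow> e \<subseteq> paths_verts Q \<Longrightarrow> e \<in> paths_edges Q"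
    by metis
  show ?case
  proof (rule Suc.IH[OF Q(1,2) _ Q(3)])
    have "M m \<subseteq> E" using M by (simp add: induced_matching_def)
    then show "\<forall>p\<in>Q. is_XY_path V E X Y p"
      using Q(4) P'_E P'_V unfolding is_XY_path_def is_path_def by blast
    show "\<forall>i<m. induced_matching E (M i)" using Suc.prems(5) by simp
    have Q_V: "paths_verts Q \<subseteq> paths_verts P'" using Q(4) by (auto simp: paths_verts_def)
    show "induced_edges E (paths_verts Q) \<subseteq> paths_edges Q \<union> (\<Union>i<m. M i)"
    proof
      fix e assume "e \<in> induced_edges E (paths_verts Q)"
      then have e: "e \<in> E" "e \<subseteq> paths_verts Q" by (auto simp: induced_edges_def)
      then have "e \<in> induced_edges E (paths_verts P)"
        using Q_V P'(5) by (auto simp: induced_edges_def)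
      \<comment> \<open>Old path edges remain path edges through both the tightening and the
        contraction, edges of \<open>M m\<close> have become path edges, and the other matchings are
        left for the induction.\<close>
      then consider "e \<in> paths_edges P" | "e \<in> M m" | "e \<in> (\<Union>i<m. M i)"
        using Suc.prems(6) by (auto simp: lessThan_Suc)
      then show "e \<in> paths_edges Q \<union> (\<Union>i<m. M i)"
      proof cases
        case 1
        then have "e \<in> paths_edges P'" using P'(6) e(2) Q_V by blast
        then show ?thesis using Q(5) e(2) by blast
      next
        case 2
        then show ?thesis using Q(5) e(2) by blast
      qed blast
    qed
  qed
qed

theorem theorem2p1:
  fixes m k :: nat
    and V :: "'a set" and E :: "'a set set"
    and X Y :: "'a set"
    and P :: "'a list set"
    and M :: "nat \<Rightarrow> 'a set set"
  assumes "k \<ge> 1"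
    and "finite_graph V E"
    and "X \<subseteq> V" and "Y \<subseteq> V"
    and "finite P" and "card P = 2 ^ m * k"
    and "\<forall>p\<in>P. is_XY_path V E X Y p"
    and "pairwise vertex_disjoint P"
    and "partition_into_induced_matchings E m M
           (induced_edges E (paths_verts P) - paths_edges P)"
  shows "\<exists>Q. finite Q \<and> card Q = k \<and> (\<forall>q\<in>Q. is_XY_path V E X Y q) \<and>
           pairwise (non_adjacent E) Q"
proof (rule nonadjacent_paths_of_cover[OF assms(2,5-8)])
  show "\<forall>i<m. induced_matching E (M i)"
    using assms(9) by (simp add: partition_into_induced_matchings_def)
  show "induced_edges E (paths_verts P) \<subseteq> paths_edges P \<union> (\<Union>i<m. M i)"
    using assms(9) unfolding partition_into_induced_matchings_def by blast
qed

end
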